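(* Let $d$ be a positive integer and let $r$ be a real number with $0<r\le(\pi/e^2)\,d^{-2d-2}$. Let $X_1,X_2,\ldots,X_{2d}$ be sets in $\mathbb{R}^d$ such that $B_1(0)\subset\operatorname{conv}(X_i)$ for all $i$. Then one can choose $x_1\in X_1,x_2\in X_2,\ldots,x_{2d}\in X_{2d}$ such that $$B_r(0)\subset\operatorname{conv}\{x_1,x_2,\ldots,x_{2d}\}.$$
   Context: $B_r(p)\subset\mathbb{R}^d$ denotes the closed Euclidean ball of radius $r$ with center $p$; $\operatorname{conv}$ is the convex hull. *)

theory Defs
  imports "HOL-Analysis.Analysis"
begin

end

theory Submission
  imports Defs
begin

text \<open>
  Write \<open>d\<close> for the dimension, with \<open>d \<ge> 2\<close>. In each of the first \<open>d\<close> sets there are at most \<open>d (d + 1)\<close> points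
  whose convex hull with \<open>0\<close> contains a cube \<open>[-a, a]\<^sup>d\<close> with \<open>a\<close> close to \<open>1 / (2 d - 2 + sqrt d)\<close>:
  represent slightly shrunken copies of \<open>e\<^sub>1, \<dots>, e\<^sub>d\<close> and \<open>-(1, \<dots>, 1) / sqrt d\<close> by Caratheodory.
  Only \<open>d (d (d + 1))\<^sup>d\<^sup>-\<^sup>1\<close> hyperplanes through \<open>0\<close> are spanned by rainbow \<open>(d - 1)\<close>-tuples of these points,
  so by comparing volumes some \<open>z\<close> in the cube has distance at least \<open>h\<close> from all of them. By the
  colorful Caratheodory theorem \<open>z \<in> conv {0, x\<^sub>1, \<dots>, x\<^sub>d}\<close> for a rainbow choice, and since \<open>z\<close> has
  distance \<open>h\<close> from all facets of the cone over the \<open>x\<^sub>i\<close>, every \<open>z + v\<close>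
  with \<open>norm v \<le> h\<close> still lies in that cone. The other \<open>d\<close> sets provide \<open>-z / (a sqrt d) \<in> conv {0, x\<^sub>d\<^sub>+\<^sub>1, \<dots>, x\<^sub>2\<^sub>d}\<close>.
  Writing \<open>v = (v + \<epsilon> z) - \<epsilon> z\<close> with \<open>\<epsilon> = 1 / (2 + a sqrt d)\<close> shows that the hull contains the ball
  of radius \<open>\<epsilon> h\<close>. For \<open>d = 1\<close> this radius is too small, but there the claim is immediate.
\<close>

section \<open>Colorful Caratheodory theorem\<close>

text \<open>The generators are an indexed family rather than a set, so that coinciding points of
  different colors keep separate coefficients.\<close>

lemma mem_convex_cone_hull_image:
  fixes x :: "'i \<Rightarrow> 'a::real_vector"
  assumes "finite I"
  shows "y \<in> convex_cone hull (x ` I) \<longleftrightarrow> (\<exists>t. (\<forall>i\<in>I. 0 \<le> t i) \<and> y = (\<Sum>i\<in>I. t i *\<^sub>R x i))"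
proof
  let ?C = "{y. \<exists>t. (\<forall>i\<in>I. 0 \<le> t i) \<and> y = (\<Sum>i\<in>I. t i *\<^sub>R x i)}"
  have "convex_cone ?C"
    unfolding convex_cone_iff
  proof (intro conjI ballI allI impI)
    show "0 \<in> ?C" by (auto intro!: exI[of _ "\<lambda>_. 0"])
    fix u v assume "u \<in> ?C" "v \<in> ?C"
    then obtain s t where "\<forall>i\<in>I. 0 \<le> s i" "u = (\<Sum>i\<in>I. s i *\<^sub>R x i)"
        "\<forall>i\<in>I. 0 \<le> t i" "v = (\<Sum>i\<in>I. t i *\<^sub>R x i)" by auto
    then show "u + v \<in> ?C"
      by (auto intro!: exI[of _ "\<lambda>i. s i + t i"] simp: scaleR_add_left sum.distrib)
  next
    fix u and c :: real assume "u \<in> ?C" "0 \<le> c"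
    then obtain s where "\<forall>i\<in>I. 0 \<le> s i" "u = (\<Sum>i\<in>I. s i *\<^sub>R x i)" by auto
    then show "c *\<^sub>R u \<in> ?C" using \<open>0 \<le> c\<close>
      by (auto intro!: exI[of _ "\<lambda>i. c * s i"] simp: scaleR_sum_right)
  qed
  moreover have "x ` I \<subseteq> ?C"
  proof
    fix z assume "z \<in> x ` I"
    then obtain j where j: "j \<in> I" "z = x j" by auto
    have "(\<Sum>i\<in>I. (if i = j then 1 else 0) *\<^sub>R x i) = (\<Sum>i\<in>I. if i = j then x i else 0)"
      by (rule sum.cong) auto
    then show "z \<in> ?C" using j assms
      by (auto intro!: exI[of _ "\<lambda>i. if i = j then 1 else 0"])
  qed
  ultimately have "convex_cone hull (x ` I) \<subseteq> ?C" by (simp add: hull_minimal)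
  then show "y \<in> convex_cone hull (x ` I) \<Longrightarrow> \<exists>t. (\<forall>i\<in>I. 0 \<le> t i) \<and> y = (\<Sum>i\<in>I. t i *\<^sub>R x i)"
    by auto
next
  assume "\<exists>t. (\<forall>i\<in>I. 0 \<le> t i) \<and> y = (\<Sum>i\<in>I. t i *\<^sub>R x i)"
  then obtain t where t: "\<forall>i\<in>I. 0 \<le> t i" "y = (\<Sum>i\<in>I. t i *\<^sub>R x i)" by auto
  have "J \<subseteq> I \<Longrightarrow> (\<Sum>i\<in>J. t i *\<^sub>R x i) \<in> convex_cone hull (x ` I)" for J
  proof (induction J rule: infinite_finite_induct)
    case (insert j J)
    then have "t j *\<^sub>R x j \<in> convex_cone hull (x ` I)"
      using t by (intro convex_cone_hull_mul) (auto intro: hull_inc)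
    with insert show ?case by (simp add: convex_cone_hull_add)
  qed (auto simp: convex_cone_hull_contains_0)
  then show "y \<in> convex_cone hull (x ` I)" using t by auto
qed

text \<open>The reduction step of Caratheodory's theorem for cones: subtracting a suitable multiple
  of a linear relation from the coefficients of \<open>y\<close> keeps them nonnegative and makes
  one of them vanish.\<close>

lemma convex_cone_hull_dependent_remove:
  fixes S :: "'a::real_vector set"
  assumes S: "finite S" "dependent S" and y: "y \<in> convex_cone hull S"
  obtains s where "s \<in> S" "y \<in> convex_cone hull (S - {s})"
proof -
  obtain t where t: "\<forall>s\<in>S. 0 \<le> t s" "y = (\<Sum>s\<in>S. t s *\<^sub>R s)"
    using y mem_convex_cone_hull_image[OF S(1), of y id] by auto
  obtain c0 where c0: "\<exists>s\<in>S. c0 s \<noteq> 0" "(\<Sum>s\<in>S. c0 s *\<^sub>R s) = 0"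
    using S by (auto simp: dependent_finite)
  \<comment> \<open>The relation may be negated, so some coefficient can be assumed positive. Only
    positive coefficients limit the multiple to be subtracted.\<close>
  obtain c where c: "\<exists>s\<in>S. c s > 0" "(\<Sum>s\<in>S. c s *\<^sub>R s) = 0"
  proof (cases "\<exists>s\<in>S. c0 s > 0")
    case True then show ?thesis using that c0 by blast
  next
    case False
    then have "\<exists>s\<in>S. - c0 s > 0" using c0 by force
    moreover have "(\<Sum>s\<in>S. (- c0 s) *\<^sub>R s) = 0" using c0 by (simp add: sum_negf)
    ultimately show ?thesis using that[of "\<lambda>s. - c0 s"] by blast
  qed
  define P where "P = {s\<in>S. c s > 0}"
  have P: "finite P" "P \<noteq> {}" using S c by (auto simp: P_def)
  \<comment> \<open>The largest multiple of the relation that can be subtracted with all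
    coefficients staying nonnegative; the coefficient of a minimizing \<open>s\<close> drops to
    0.\<close>
  define m where "m = Min ((\<lambda>s. t s / c s) ` P)"
  have "m \<in> (\<lambda>s. t s / c s) ` P" unfolding m_def using P by (intro Min_in) auto
  then obtain s where s: "s \<in> P" "m = t s / c s" by auto
  have m0: "0 \<le> m" using s t by (auto simp: P_def)
  have le: "m \<le> t q / c q" if "q \<in> P" for q using that P by (auto simp: m_def)
  define t' where "t' q = t q - m * c q" for q
  have nn: "0 \<le> t' q" if "q \<in> S" for q
  proof (cases "c q > 0")
    case True
    then show ?thesis using le[of q] that by (auto simp: P_def t'_def field_simps)
  next
    case False
    then have "m * c q \<le> 0" using m0 by (simp add: mult_nonneg_nonpos)
    then show ?thesis using t that by (auto simp: t'_def)
  qed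
  have "t' s = 0" using s by (auto simp: t'_def P_def)
  have "y = (\<Sum>q\<in>S. t' q *\<^sub>R q) + m *\<^sub>R (\<Sum>q\<in>S. c q *\<^sub>R q)"
    by (simp add: t t'_def scaleR_diff_left sum_subtractf scaleR_sum_right)
  also have "\<dots> = (\<Sum>q\<in>S. t' q *\<^sub>R q)" using c by simp
  also have "\<dots> = (\<Sum>q\<in>S - {s}. t' q *\<^sub>R q)"
    using \<open>t' s = 0\<close> S by (simp add: sum_diff1)
  finally have "y \<in> convex_cone hull (id ` (S - {s}))"
    using nn mem_convex_cone_hull_image[of "S - {s}" y id] S by auto
  then show ?thesis using that[of s] s by (auto simp: P_def)
qed

text \<open>Barany's argument: take a rainbow choice whose cone comes closest to \<open>a\<close>,
  and let \<open>y\<close> be the nearest point. If \<open>y \<noteq> a\<close>, then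
  \<open>y\<close> already lies in the cone over all colors but one, and replacing the point of that
  color by one strictly on the side of \<open>a\<close> brings the cone closer.\<close>

lemma colorful_caratheodory_cone:
  fixes X :: "'i \<Rightarrow> 'a::euclidean_space set"
  assumes I: "finite I" "card I = DIM('a)"
    and fin: "\<And>i. i \<in> I \<Longrightarrow> finite (X i)"
    and a: "\<And>i. i \<in> I \<Longrightarrow> a \<in> convex_cone hull (X i)"
    and ne: "\<And>i. i \<in> I \<Longrightarrow> X i \<noteq> {}"
  obtains x where "\<And>i. i \<in> I \<Longrightarrow> x i \<in> X i" "a \<in> convex_cone hull (x ` I)"
proof -
  define C where "C x = convex_cone hull (x ` I)" for x :: "'i \<Rightarrow> 'a"
  have C: "convex (C x)" "closed (C x)" "C x \<noteq> {}" for x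
    unfolding C_def using I
    by (auto simp: convex_convex_cone_hull closed_convex_cone_hull convex_cone_hull_nonempty)
  define F where "F = PiE I X"
  have F: "finite F" "F \<noteq> {}" using fin ne I by (auto simp: F_def PiE_eq_empty_iff intro: finite_PiE)
  obtain x where x: "x \<in> F" "\<And>x'. x' \<in> F \<Longrightarrow> infdist a (C x) \<le> infdist a (C x')"
    using ex_is_arg_min_if_finite[OF F, of "\<lambda>x. infdist a (C x)"]
    by (auto simp: is_arg_min_linorder)
  obtain y where y: "y \<in> C x" "infdist a (C x) = dist a y"
    using infdist_attains_inf[OF C(2,3)] by blast
  have "y = a"
  proof (rule ccontr)
    assume "y \<noteq> a"
    define u where "u = a - y"
    have "u \<noteq> 0" using \<open>y \<noteq> a\<close> by (simp add: u_def)
    have dot: "u \<bullet> (c - y) \<le> 0" if "c \<in> C x" for c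
      using any_closest_point_dot[OF C(1,2) y(1) that] y(2) infdist_le[of _ "C x" a]
      by (simp add: u_def)
    have cc: "convex_cone (C x)" by (simp add: C_def convex_cone_convex_cone_hull)
    \<comment> \<open>The nearest-point inequality is tested at \<open>0\<close> and at
      \<open>2 *\<^sub>R y\<close>, both in the cone; the two signs force orthogonality.\<close>
    have uy: "u \<bullet> y = 0"
    proof -
      have "0 \<in> C x" "2 *\<^sub>R y \<in> C x"
        using y cc by (auto simp: convex_cone_iff)
      then have "u \<bullet> (0 - y) \<le> 0" "u \<bullet> (2 *\<^sub>R y - y) \<le> 0" using dot by blast+
      then show ?thesis by (simp add: inner_diff_right)
    qed
    have uc: "u \<bullet> c \<le> 0" if "c \<in> C x" for c
      using dot[OF that] uy by (simp add: inner_diff_right)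
    have "u \<bullet> a > 0" using uy \<open>u \<noteq> 0\<close> by (metis add.right_neutral diff_add_cancel inner_add_right inner_gt_zero_iff u_def)
    obtain i where i: "i \<in> I" "y \<in> convex_cone hull (x ` (I - {i}))"
    proof -
      obtain t where t: "\<forall>i\<in>I. 0 \<le> t i" "y = (\<Sum>i\<in>I. t i *\<^sub>R x i)"
        using y mem_convex_cone_hull_image[OF I(1), of y x] by (auto simp: C_def)
      have xC: "x i \<in> C x" if "i \<in> I" for i using that by (auto simp: C_def intro: hull_inc)
      show ?thesis
      proof (cases "\<exists>i\<in>I. t i = 0")
        case True
        then obtain i where i: "i \<in> I" "t i = 0" by auto
        then have "y = (\<Sum>i\<in>I-{i}. t i *\<^sub>R x i)" using t I by (simp add: sum_diff1)
        then show ?thesis using that[OF i(1)] mem_convex_cone_hull_image[of "I - {i}" y x] t I by auto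
      next
        case False
        have "(\<Sum>i\<in>I. - (t i * (u \<bullet> x i))) = 0"
          using uy t by (simp add: inner_sum_right sum_negf)
        then have "\<forall>i\<in>I. - (t i * (u \<bullet> x i)) = 0"
          using I t uc[OF xC] by (subst (asm) sum_nonneg_eq_0_iff) (auto simp: mult_nonneg_nonpos)
        then have ux: "u \<bullet> x i = 0" if "i \<in> I" for i using that False by auto
        show ?thesis
        proof (cases "inj_on x I")
          case True
          then have "card (x ` I) = DIM('a)" using I by (simp add: card_image)
          moreover have "dim (x ` I) \<le> dim {v. u \<bullet> v = 0}" by (rule dim_subset) (use ux in auto)
          moreover have "dim {v. u \<bullet> v = 0} < DIM('a)"
            using dim_hyperplane[OF \<open>u \<noteq> 0\<close>] by simp
          ultimately have "dependent (x ` I)"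
            using independent_card_le_dim[of "x ` I" "x ` I"] by fastforce
          then obtain s where "s \<in> x ` I" "y \<in> convex_cone hull (x ` I - {s})"
            using convex_cone_hull_dependent_remove[of "x ` I" y] I y(1)
            unfolding C_def by blast
          then obtain i where "i \<in> I" "s = x i" by blast
          moreover have "x ` I - {x i} = x ` (I - {i})"
            using True \<open>i \<in> I\<close> by (auto simp: inj_on_def)
          ultimately show ?thesis
            using that \<open>y \<in> convex_cone hull (x ` I - {s})\<close> by simp
        next
          case False
          then obtain i j where ij: "i \<in> I" "j \<in> I" "i \<noteq> j" "x i = x j" by (auto simp: inj_on_def)
          then have "x i \<in> x ` (I - {i})" by (metis Diff_iff image_eqI singletonD)
          then have "x ` (I - {i}) = x ` I"
            using ij by (metis image_insert insert_Diff insert_absorb)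
          then show ?thesis using that[OF ij(1)] y by (simp add: C_def)
        qed
      qed
    qed
    \<comment> \<open>Otherwise a half-space would contain the cone over \<open>X i\<close> but not
      \<open>a\<close>.\<close>
    have "\<exists>x'\<in>X i. u \<bullet> x' > 0"
    proof (rule ccontr)
      assume "\<not> ?thesis"
      then have "X i \<subseteq> {v. u \<bullet> v \<le> 0}" by (auto simp: not_less)
      then have "convex_cone hull (X i) \<subseteq> {v. u \<bullet> v \<le> 0}"
        by (simp add: hull_minimal convex_cone_halfspace_le)
      then show False using a[OF i(1)] \<open>u \<bullet> a > 0\<close> by auto
    qed
    then obtain x' where x': "x' \<in> X i" "u \<bullet> x' > 0" by auto
    define z where "z = x(i := x')"
    have "z \<in> F" using x(1) i x' by (auto simp: F_def z_def PiE_iff extensional_def)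
    have zim: "z ` I = insert x' (x ` (I - {i}))" using i by (auto simp: z_def)
    \<comment> \<open>\<open>s *\<^sub>R x'\<close> is the orthogonal projection of \<open>u\<close>
      onto the line through \<open>x'\<close>. It is nonzero, so subtracting it shortens
      \<open>u\<close>.\<close>
    define s where "s = (u \<bullet> x') / (x' \<bullet> x')"
    have "x' \<noteq> 0" using x' by auto
    have "s > 0" using x' \<open>x' \<noteq> 0\<close> by (auto simp: s_def)
    have "y \<in> C z" using i(2) unfolding C_def zim by (meson hull_mono subsetD subset_insertI)
    then have "y + s *\<^sub>R x' \<in> C z"
      unfolding C_def zim using \<open>s > 0\<close> by (intro convex_cone_hull_add convex_cone_hull_mul) (auto intro: hull_inc)
    then have "infdist a (C z) \<le> dist a (y + s *\<^sub>R x')" by (rule infdist_le)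
    also have "\<dots> = norm (u - s *\<^sub>R x')" by (simp add: dist_norm u_def algebra_simps)
    also have "\<dots> < norm u"
    proof -
      have "(norm (u - s *\<^sub>R x'))\<^sup>2 = (norm u)\<^sup>2 - 2 * s * (u \<bullet> x') + s * (s * (x' \<bullet> x'))"
        by (simp add: power2_norm_eq_inner inner_diff inner_commute algebra_simps)
      also have "s * (x' \<bullet> x') = u \<bullet> x'" using \<open>x' \<noteq> 0\<close> by (simp add: s_def)
      finally have "(norm (u - s *\<^sub>R x'))\<^sup>2 < (norm u)\<^sup>2" using \<open>s > 0\<close> x' by simp
      then show ?thesis by (simp add: power2_less_imp_less)
    qed
    finally show False using x(2)[OF \<open>z \<in> F\<close>] y(2) by (simp add: u_def dist_norm)
  qed
  then show ?thesis using that[of x] x(1) y by (auto simp: F_def C_def)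
qed

section \<open>From cones to convex hulls with the origin adjoined\<close>

text \<open>The missing weight \<open>1 - sum c I\<close> is put on the point
  \<open>0\<close>.\<close>

lemma convex_sum_le_1:
  fixes y :: "'i \<Rightarrow> 'a::real_vector"
  assumes "finite I" "convex C" "0 \<in> C" "\<And>i. i \<in> I \<Longrightarrow> 0 \<le> c i" "sum c I \<le> 1"
    "\<And>i. i \<in> I \<Longrightarrow> y i \<in> C"
  shows "(\<Sum>i\<in>I. c i *\<^sub>R y i) \<in> C"
proof (cases "sum c I = 0")
  case True
  then have "\<forall>i\<in>I. c i = 0" using assms by (subst (asm) sum_nonneg_eq_0_iff) auto
  then show ?thesis using assms by simp
next
  case False
  define s where "s = sum c I"
  have s: "s > 0" "s \<le> 1" using False assms by (auto simp: s_def sum_nonneg less_le)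
  have "(\<Sum>i\<in>I. (c i / s) *\<^sub>R y i) \<in> C"
    using assms s by (intro convex_sum) (auto simp: s_def sum_divide_distrib[symmetric])
  then have "(1 - s) *\<^sub>R 0 + s *\<^sub>R (\<Sum>i\<in>I. (c i / s) *\<^sub>R y i) \<in> C"
    using assms s by (intro convexD) auto
  then show ?thesis using s by (simp add: scaleR_sum_right)
qed

lemma mem_convex_hull_insert_0_image:
  fixes x :: "'i \<Rightarrow> 'a::real_vector"
  assumes "finite I" "y \<in> convex hull (insert 0 (x ` I))"
  obtains t where "\<And>i. i \<in> I \<Longrightarrow> 0 \<le> t i" "sum t I \<le> 1" "y = (\<Sum>i\<in>I. t i *\<^sub>R x i)"
proof -
  let ?C = "{y. \<exists>t. (\<forall>i\<in>I. 0 \<le> t i) \<and> sum t I \<le> 1 \<and> y = (\<Sum>i\<in>I. t i *\<^sub>R x i)}"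
  have "convex ?C"
  proof (rule convexI)
    fix p q and u v :: real assume "p \<in> ?C" "q \<in> ?C" and uv: "0 \<le> u" "0 \<le> v" "u + v = 1"
    then obtain s t where s: "\<forall>i\<in>I. 0 \<le> s i" "sum s I \<le> 1" "p = (\<Sum>i\<in>I. s i *\<^sub>R x i)"
      and t: "\<forall>i\<in>I. 0 \<le> t i" "sum t I \<le> 1" "q = (\<Sum>i\<in>I. t i *\<^sub>R x i)" by auto
    have "sum (\<lambda>i. u * s i + v * t i) I = u * sum s I + v * sum t I"
      by (simp add: sum.distrib sum_distrib_left)
    also have "\<dots> \<le> 1" using s t uv by (intro convex_bound_le) auto
    finally show "u *\<^sub>R p + v *\<^sub>R q \<in> ?C" using s t uv
      by (auto intro!: exI[of _ "\<lambda>i. u * s i + v * t i"]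
          simp: scaleR_add_left sum.distrib scaleR_sum_right)
  qed
  moreover have "insert 0 (x ` I) \<subseteq> ?C"
  proof
    fix z assume "z \<in> insert 0 (x ` I)"
    then consider "z = 0" | j where "j \<in> I" "z = x j" by auto
    then show "z \<in> ?C"
    proof cases
      case 1
      then show ?thesis by (auto intro!: exI[of _ "\<lambda>_. 0"])
    next
      case (2 j)
      have "(\<Sum>i\<in>I. (if i = j then 1 else 0) *\<^sub>R x i) = (\<Sum>i\<in>I. if i = j then x i else 0)"
        by (rule sum.cong) auto
      then show ?thesis using 2 assms
        by (auto intro!: exI[of _ "\<lambda>i. if i = j then 1 else 0"])
    qed
  qed
  ultimately have "convex hull (insert 0 (x ` I)) \<subseteq> ?C" by (rule hull_minimal[rotated])
  then show ?thesis using assms that by blast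
qed

text \<open>The slack \<open>e\<close> is what allows the conic form of the colorful theorem, applied to the translates
  \<open>X i - v\<close>, to yield membership in \<open>conv {0, x\<^sub>1, \<dots>, x\<^sub>d}\<close> rather than only in the cone.\<close>

lemma mem_convex_cone_hull_translate:
  fixes X :: "'a::real_vector set"
  assumes "e > 0" "(1 + e) *\<^sub>R v \<in> convex hull (insert 0 X)"
  shows "v \<in> convex_cone hull ((\<lambda>x. x - v) ` X)"
proof -
  define K where "K = convex_cone hull ((\<lambda>x. x - v) ` X)"
  have K: "convex_cone K" by (simp add: K_def convex_cone_convex_cone_hull)
  \<comment> \<open>This set is convex and contains \<open>0\<close> (with \<open>c = 0\<close>) and
    \<open>X\<close> (with \<open>c = 1\<close>), hence the whole hull. At
    \<open>(1 + e) *\<^sub>R v\<close> it gives a multiple of \<open>v\<close> in \<open>K\<close>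
    with factor \<open>1 + e - c\<close>, which is positive.\<close>
  let ?C = "{w. \<exists>c\<le>1. w - c *\<^sub>R v \<in> K}"
  have "convex ?C"
  proof (rule convexI)
    fix p q and a b :: real assume "p \<in> ?C" "q \<in> ?C" and ab: "0 \<le> a" "0 \<le> b" "a + b = 1"
    then obtain c d where c: "c \<le> 1" "p - c *\<^sub>R v \<in> K" and d: "d \<le> 1" "q - d *\<^sub>R v \<in> K" by auto
    have "a *\<^sub>R (p - c *\<^sub>R v) + b *\<^sub>R (q - d *\<^sub>R v) \<in> K"
      using K c d ab by (simp add: convex_cone_iff)
    moreover have "a * c + b * d \<le> 1" using c d ab by (intro convex_bound_le) auto
    ultimately show "a *\<^sub>R p + b *\<^sub>R q \<in> ?C"
      by (auto intro!: exI[of _ "a * c + b * d"] simp: algebra_simps)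
  qed
  moreover have "0 \<in> ?C" using K by (auto intro!: exI[of _ 0] simp: convex_cone_contains_0)
  moreover have "x \<in> ?C" if "x \<in> X" for x
    using that by (auto intro!: exI[of _ 1] hull_inc simp: K_def)
  ultimately have "convex hull (insert 0 X) \<subseteq> ?C" by (intro hull_minimal) auto
  then obtain c where c: "c \<le> 1" "(1 + e) *\<^sub>R v - c *\<^sub>R v \<in> K" using assms by auto
  then have "(1 + e - c) *\<^sub>R v \<in> K" by (simp only: scaleR_diff_left)
  then have "(1 / (1 + e - c)) *\<^sub>R ((1 + e - c) *\<^sub>R v) \<in> K"
    by (rule convex_cone_scaleR[OF K, rotated]) (use c(1) assms(1) in simp)
  moreover have "(1 / (1 + e - c)) *\<^sub>R ((1 + e - c) *\<^sub>R v) = v"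
    using c assms(1) by (simp only: scaleR_scaleR) simp
  ultimately show ?thesis by (simp only: K_def)
qed

text \<open>The conic theorem for the translates \<open>X i - v\<close> gives \<open>v\<close> as
  the sum of \<open>t i *\<^sub>R (x i - v)\<close>. Solving for \<open>v\<close> turns the
  coefficients into \<open>t i / (1 + T)\<close> with \<open>T = sum t I\<close>, and these add up
  to less than 1.\<close>

lemma colorful_caratheodory_insert_0:
  fixes X :: "'i \<Rightarrow> 'a::euclidean_space set"
  assumes I: "finite I" "card I = DIM('a)"
    and ne: "\<And>i. i \<in> I \<Longrightarrow> X i \<noteq> {}"
    and "e > 0" and v: "\<And>i. i \<in> I \<Longrightarrow> (1 + e) *\<^sub>R v \<in> convex hull (insert 0 (X i))"
  obtains x where "\<And>i. i \<in> I \<Longrightarrow> x i \<in> X i" "v \<in> convex hull (insert 0 (x ` I))"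
proof -
  have "\<exists>S. finite S \<and> S \<noteq> {} \<and> S \<subseteq> X i \<and> (1 + e) *\<^sub>R v \<in> convex hull (insert 0 S)" if i: "i \<in> I" for i
  proof -
    obtain S where S: "finite S" "S \<subseteq> insert 0 (X i)" "(1 + e) *\<^sub>R v \<in> convex hull S"
      using v[OF i] caratheodory[of "insert 0 (X i)"] by blast
    \<comment> \<open>The finite set supplied by Caratheodory may consist of \<open>0\<close> alone;
      adding \<open>p\<close> keeps the color nonempty.\<close>
    obtain p where p: "p \<in> X i" using ne[OF i] by auto
    let ?S = "insert p (S - {0})"
    have "S \<subseteq> insert 0 ?S" by auto
    then have "(1 + e) *\<^sub>R v \<in> convex hull (insert 0 ?S)"
      using S(3) hull_mono[of S "insert 0 ?S" convex] by blast
    moreover have "?S \<subseteq> X i" using S(2) p \<open>p \<in> X i\<close> by auto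
    ultimately show ?thesis using S(1) by (intro exI[of _ ?S]) simp
  qed
  then obtain S where S: "\<And>i. i \<in> I \<Longrightarrow> finite (S i)" "\<And>i. i \<in> I \<Longrightarrow> S i \<noteq> {}"
    "\<And>i. i \<in> I \<Longrightarrow> S i \<subseteq> X i" "\<And>i. i \<in> I \<Longrightarrow> (1 + e) *\<^sub>R v \<in> convex hull (insert 0 (S i))"
    by metis
  have "v \<in> convex_cone hull ((\<lambda>x. x - v) ` S i)" if "i \<in> I" for i
    using mem_convex_cone_hull_translate[OF \<open>e > 0\<close> S(4)[OF that]] .
  then obtain w where w: "\<And>i. i \<in> I \<Longrightarrow> w i \<in> (\<lambda>x. x - v) ` S i" "v \<in> convex_cone hull (w ` I)"
    using colorful_caratheodory_cone[of I "\<lambda>i. (\<lambda>x. x - v) ` S i" v] I S(1,2) by auto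
  define x where "x i = w i + v" for i
  have x: "x i \<in> X i" if "i \<in> I" for i using w(1)[OF that] S(3)[OF that] by (auto simp: x_def)
  obtain t where t: "\<forall>i\<in>I. 0 \<le> t i" "v = (\<Sum>i\<in>I. t i *\<^sub>R w i)"
    using w(2) mem_convex_cone_hull_image[OF I(1)] by blast
  define T where "T = sum t I"
  have T: "T \<ge> 0" using t by (simp add: T_def sum_nonneg)
  have "(1 + T) *\<^sub>R v = (\<Sum>i\<in>I. t i *\<^sub>R w i) + (\<Sum>i\<in>I. t i *\<^sub>R v)"
    using t(2) by (simp add: T_def algebra_simps scaleR_sum_left)
  also have "\<dots> = (\<Sum>i\<in>I. t i *\<^sub>R x i)" by (simp add: x_def scaleR_add_right sum.distrib)
  finally have "(1 / (1 + T)) *\<^sub>R ((1 + T) *\<^sub>R v) = (\<Sum>i\<in>I. (t i / (1 + T)) *\<^sub>R x i)"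
    by (simp add: scaleR_sum_right)
  then have "v = (\<Sum>i\<in>I. (t i / (1 + T)) *\<^sub>R x i)" using T by simp
  also have "\<dots> \<in> convex hull (insert 0 (x ` I))"
    using I t T by (intro convex_sum_le_1) (auto intro: hull_inc simp: sum_divide_distrib[symmetric] T_def[symmetric])
  finally show ?thesis using that x by blast
qed

section \<open>A large cube in the hull of few points\<close>

text \<open>A point \<open>z\<close> is the sum of \<open>(z $ j + m) *\<^sub>R axis j 1\<close>
  minus \<open>m\<close> times the all-ones vector, where \<open>m\<close> is the least nonnegative
  shift making the coordinates nonnegative. If \<open>m > 0\<close>, one shifted coordinate is 0 and
  the others are at most \<open>2 * a\<close>; the all-ones part has weight
  \<open>m * sqrt d\<close>. This explains the denominator.\<close>

lemma finite_subset_hull_contains_cube: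
  fixes X :: "(real ^ 'd) set"
  assumes X: "cball 0 1 \<subseteq> convex hull X" and \<theta>: "0 < \<theta>" "\<theta> < 1"
  obtains A where "finite A" "A \<noteq> {}" "A \<subseteq> X" "card A \<le> CARD('d) * (CARD('d) + 1)"
    "\<And>z. (\<And>k. \<bar>z $ k\<bar> \<le> \<theta> / (2 * real CARD('d) - 2 + sqrt (real CARD('d)))) \<Longrightarrow>
       z \<in> convex hull (insert 0 A)"
proof -
  define d where "d = real CARD('d)"
  have d: "d \<ge> 1" by (simp add: d_def Suc_le_eq)
  define v :: "'d option \<Rightarrow> real ^ 'd" where
    "v q = (case q of None \<Rightarrow> (\<chi> k. - (\<theta> / sqrt d)) | Some k \<Rightarrow> \<theta> *\<^sub>R axis k 1)" for q
  have nv: "norm (v q) \<le> \<theta>" for q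
  proof (cases q)
    case None
    have "norm (v q) = sqrt (d * (\<theta> / sqrt d)\<^sup>2)"
      by (simp add: None v_def norm_vec_def L2_set_def d_def power_divide)
    also have "\<dots> = \<theta>" using d \<theta> by (simp add: power_divide)
    finally show ?thesis by simp
  next
    case (Some k)
    then show ?thesis using \<theta> by (simp add: v_def norm_axis_1)
  qed
  have "X \<noteq> {}" using X by auto
  have "\<exists>B. finite B \<and> B \<noteq> {} \<and> B \<subseteq> X \<and> card B \<le> CARD('d) \<and> v q \<in> convex hull (insert 0 B)" for q
  proof -
    \<comment> \<open>With all colors equal to \<open>X\<close>, the colorful theorem yields a
      Caratheodory representation by at most \<open>CARD('d)\<close> points besides
      \<open>0\<close>. The shrinking by \<open>\<theta>\<close> pays for the required slack
      \<open>1 / \<theta> - 1\<close>.\<close>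
    have "norm ((1 + (1 / \<theta> - 1)) *\<^sub>R v q) \<le> 1" using nv[of q] \<theta> by (simp add: field_simps)
    then have "(1 + (1 / \<theta> - 1)) *\<^sub>R v q \<in> convex hull X" using X by (auto simp: mem_cball_0)
    then have "(1 + (1 / \<theta> - 1)) *\<^sub>R v q \<in> convex hull (insert 0 X)"
      using hull_mono[of X "insert 0 X" convex] by blast
    then obtain x where x: "\<And>i. i \<in> {..<CARD('d)} \<Longrightarrow> x i \<in> X" "v q \<in> convex hull (insert 0 (x ` {..<CARD('d)}))"
      using colorful_caratheodory_insert_0[of "{..<CARD('d)}" "\<lambda>_. X" "1 / \<theta> - 1" "v q"] \<open>X \<noteq> {}\<close> \<theta>
      by auto
    then show ?thesis
      by (intro exI[of _ "x ` {..<CARD('d)}"]) (auto intro: order_trans[OF card_image_le] simp: lessThan_empty_iff)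
  qed
  then obtain B where B: "\<And>q. finite (B q)" "\<And>q. B q \<noteq> {}" "\<And>q. B q \<subseteq> X"
    "\<And>q. card (B q) \<le> CARD('d)" "\<And>q. v q \<in> convex hull (insert 0 (B q))"
    by metis
  define A where "A = (\<Union>q. B q)"
  have "card A \<le> (\<Sum>q\<in>(UNIV :: 'd option set). card (B q))"
    unfolding A_def by (rule card_UN_le) simp
  also have "\<dots> \<le> CARD('d option) * CARD('d)"
    using sum_bounded_above[of "UNIV :: 'd option set" "\<lambda>q. card (B q)"] B by simp
  also have "\<dots> = CARD('d) * (CARD('d) + 1)" by (simp add: card_UNIV_option)
  finally have cA: "card A \<le> CARD('d) * (CARD('d) + 1)" .
  have vA: "v q \<in> convex hull (insert 0 A)" for q
    using B(5)[of q] hull_mono[of "insert 0 (B q)" "insert 0 A" convex] by (auto simp: A_def)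
  have "z \<in> convex hull (insert 0 A)"
    if z: "\<And>k. \<bar>z $ k\<bar> \<le> \<theta> / (2 * d - 2 + sqrt d)" for z
  proof -
    define a where "a = \<theta> / (2 * d - 2 + sqrt d)"
    have "sqrt d \<ge> 1" using d by simp
    then have "2 * d - 2 + sqrt d > 0" using d by linarith
    then have a: "a > 0" "a * (2 * d - 2 + sqrt d) = \<theta>" using \<theta> by (auto simp: a_def)
    have z: "\<bar>z $ k\<bar> \<le> a" for k using z by (simp add: a_def)
    obtain k where k: "\<And>j. z $ k \<le> z $ j"
      using ex_is_arg_min_if_finite[of "UNIV :: 'd set" "\<lambda>k. z $ k"] by (auto simp: is_arg_min_linorder)
    define m where "m = max 0 (- (z $ k))"
    have m: "0 \<le> m" "m \<le> a" "\<And>j. 0 \<le> z $ j + m"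
      using a(1) z[of k] k by (auto simp: m_def max_def abs_le_iff not_le) (smt (verit) k)+
    have tot: "(\<Sum>j\<in>UNIV. z $ j + m) + m * sqrt d \<le> \<theta>"
    proof (cases "z $ k < 0")
      case True
      have "(\<Sum>j\<in>UNIV. z $ j + m) = (z $ k + m) + (\<Sum>j\<in>UNIV - {k}. z $ j + m)"
        by (simp add: sum.remove)
      also have "\<dots> \<le> 0 + (d - 1) * (2 * a)"
      proof (rule add_mono)
        show "z $ k + m \<le> 0" using True by (simp add: m_def)
        have "z $ j + m \<le> 2 * a" for j using z[of j] m(2) by (simp add: abs_le_iff)
        then have "(\<Sum>j\<in>UNIV - {k}. z $ j + m) \<le> real (card (UNIV - {k})) * (2 * a)"
          by (intro sum_bounded_above)
        then show "(\<Sum>j\<in>UNIV - {k}. z $ j + m) \<le> (d - 1) * (2 * a)"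
          by (simp add: d_def card_Diff_singleton of_nat_diff Suc_le_eq)
      qed
      finally have "(\<Sum>j\<in>UNIV. z $ j + m) \<le> (d - 1) * (2 * a)" by simp
      moreover have "m * sqrt d \<le> a * sqrt d" using m d by (intro mult_right_mono) auto
      ultimately show ?thesis using a(2) by (simp add: algebra_simps)
    next
      case False
      then have "m = 0" by (simp add: m_def)
      have "(\<Sum>j\<in>UNIV. z $ j) \<le> d * a"
        using sum_bounded_above[of UNIV "\<lambda>j. z $ j" a] z by (simp add: d_def abs_le_iff)
      also have "\<dots> \<le> (2 * d - 2 + sqrt d) * a"
      proof (intro mult_right_mono)
        have "d \<le> 2 * d - 2 + 1" using d by simp
        then show "d \<le> 2 * d - 2 + sqrt d" using \<open>sqrt d \<ge> 1\<close> by linarith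
      qed (use a in auto)
      finally show ?thesis using a \<open>m = 0\<close> by (simp add: algebra_simps)
    qed
    \<comment> \<open>Division by \<open>\<theta>\<close> compensates for the vectors
      \<open>v q\<close> having length \<open>\<theta>\<close>; \<open>tot\<close> then says that
      the weights sum to at most 1.\<close>
    define c where "c q = (case q of None \<Rightarrow> m * sqrt d / \<theta> | Some j \<Rightarrow> (z $ j + m) / \<theta>)" for q :: "'d option"
    have "(\<Sum>q\<in>UNIV. c q *\<^sub>R v q) \<in> convex hull (insert 0 A)"
    proof (rule convex_sum_le_1)
      show "0 \<le> c q" for q using m \<theta> d by (auto simp: c_def split: option.split)
      have "sum c UNIV = (m * sqrt d + (\<Sum>j\<in>UNIV. z $ j + m)) / \<theta>"
        by (simp add: UNIV_option_conv sum.reindex c_def add_divide_distrib sum_divide_distrib)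
      also have "\<dots> \<le> 1" using tot \<theta> by (simp add: add.commute)
      finally show "sum c UNIV \<le> 1" .
    qed (auto simp: vA intro: hull_inc)
    also have "(\<Sum>q\<in>UNIV. c q *\<^sub>R v q) = z"
    proof (rule vec_eq_iff[THEN iffD2], rule allI)
      fix i
      have "(\<Sum>q\<in>UNIV. c q *\<^sub>R v q) $ i = - m + (\<Sum>j\<in>UNIV. (z $ j + m) * axis j 1 $ i)"
        using \<theta> d by (simp add: UNIV_option_conv sum.reindex c_def v_def)
      also have "(\<Sum>j\<in>UNIV. (z $ j + m) * axis j 1 $ i) = (\<Sum>j\<in>UNIV. if j = i then z $ j + m else 0)"
        by (rule sum.cong) (auto simp: axis_def)
      finally show "(\<Sum>q\<in>UNIV. c q *\<^sub>R v q) $ i = z $ i" by simp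
    qed
    finally show ?thesis .
  qed
  moreover have "finite A" "A \<noteq> {}" "A \<subseteq> X" using B by (auto simp: A_def)
  ultimately show ?thesis using that cA by (simp add: d_def)
qed

section \<open>A point far from finitely many hyperplanes\<close>

lemma exists_large_component:
  fixes u :: "real ^ 'd"
  assumes "norm u = 1"
  obtains k where "1 / sqrt (real CARD('d)) \<le> \<bar>u $ k\<bar>"
proof -
  have "\<exists>k. 1 / real CARD('d) \<le> (u $ k)\<^sup>2"
  proof (rule ccontr)
    assume "\<not> ?thesis"
    then have "(\<Sum>k\<in>UNIV. (u $ k)\<^sup>2) < (\<Sum>k\<in>(UNIV::'d set). 1 / real CARD('d))"
      by (intro sum_strict_mono) (auto simp: not_le)
    moreover have "(\<Sum>k\<in>UNIV. (u $ k)\<^sup>2) = (norm u)\<^sup>2"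
      by (simp add: norm_vec_def L2_set_def sum_nonneg)
    ultimately show False using assms by simp
  qed
  then obtain k where "1 / real CARD('d) \<le> (u $ k)\<^sup>2" by auto
  then have "sqrt (1 / real CARD('d)) \<le> sqrt ((u $ k)\<^sup>2)" by (rule real_sqrt_le_mono)
  then show ?thesis using that[of k] by (simp add: real_sqrt_divide)
qed

section \<open>Volume of a slab inside a cube\<close>

lemma measure_cube:
  assumes "0 \<le> a"
  shows "measure lebesgue (cbox (\<chi> k. - a) (\<chi> k. a) :: (real ^ 'd) set) = (2 * a) ^ CARD('d)"
proof -
  have "(0 :: real ^ 'd) \<in> cbox (\<chi> k. - a) (\<chi> k. a)" using assms by (simp add: mem_box_cart)
  then have "cbox (\<chi> k. - a) (\<chi> k. a) \<noteq> ({} :: (real ^ 'd) set)" by blast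
  then show ?thesis by (simp add: content_cbox_cart)
qed

lemma slab_lmeasurable: "{z \<in> cbox p q. \<bar>u \<bullet> z\<bar> < h} \<in> lmeasurable"
proof -
  have "{z \<in> cbox p q. \<bar>u \<bullet> z\<bar> < h} = cbox p q \<inter> {z. \<bar>u \<bullet> z\<bar> < h}" by auto
  moreover have "open {z. \<bar>u \<bullet> z\<bar> < h}" by (intro open_Collect_less continuous_intros)
  ultimately show ?thesis by (simp add: lmeasurable_cbox fmeasurable_Int_fmeasurable fmeasurableI2 borel_open)
qed

text \<open>Translates of the slab by multiples of \<open>2 * h / \<bar>u $ k\<bar>\<close> along the \<open>k\<close>-th axis are disjoint, and
  \<open>n\<close> of them fit into a box whose volume grows like \<open>n\<close> times the claimed bound.\<close>

lemma measure_cube_slab_le: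
  fixes u :: "real ^ 'd"
  assumes u: "norm u = 1" and "0 \<le> a" "0 < h"
  shows "measure lebesgue {z \<in> cbox (\<chi> k. - a) (\<chi> k. a). \<bar>u \<bullet> z\<bar> < h}
           \<le> (2 * a) ^ (CARD('d) - 1) * (2 * h) * sqrt (real CARD('d))"
proof -
  define S where "S = {z \<in> cbox (\<chi> k. - a) (\<chi> k. a). \<bar>u \<bullet> z\<bar> < h}"
  have S: "S \<in> lmeasurable" unfolding S_def by (rule slab_lmeasurable)
  obtain k where k: "1 / sqrt (real CARD('d)) \<le> \<bar>u $ k\<bar>" using exists_large_component[OF u] .
  have "0 < 1 / sqrt (real CARD('d))" by simp
  then have uk: "\<bar>u $ k\<bar> > 0" using k by linarith
  define s where "s = 2 * h / \<bar>u $ k\<bar>"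
  have "s > 0" using uk \<open>0 < h\<close> by (simp add: s_def)
  define c where "c = (2 * a) ^ (CARD('d) - 1)"
  define T where "T j = (+) ((real j * s) *\<^sub>R axis k 1) ` S" for j :: nat
  have T: "T j \<in> lmeasurable" "measure lebesgue (T j) = measure lebesgue S" for j
    using S by (simp_all add: T_def measurable_translation measure_translation)
  \<comment> \<open>On the translate \<open>T j\<close> the functional \<open>u\<close> takes values
    in the open interval of radius \<open>h\<close> around
    \<open>2 * h * sgn (u $ k) * real j\<close>. These intervals are disjoint for different
    \<open>j\<close>.\<close>
  have inner_T: "\<exists>y. \<bar>y\<bar> < h \<and> u \<bullet> z = 2 * h * sgn (u $ k) * real j + y" if "z \<in> T j" for z j
  proof -
    obtain w where w: "w \<in> S" "z = (real j * s) *\<^sub>R axis k 1 + w"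
      using \<open>z \<in> T j\<close> unfolding T_def by blast
    have "u \<bullet> z = real j * (s * u $ k) + u \<bullet> w" by (simp add: w inner_add_right inner_axis)
    also have "s * u $ k = 2 * h * sgn (u $ k)" using uk by (simp add: s_def sgn_if)
    finally show ?thesis using w by (intro exI[of _ "u \<bullet> w"]) (auto simp: S_def)
  qed
  have disj: "disjoint_family_on T {..<n}" for n
    unfolding disjoint_family_on_def
  proof (intro ballI impI equals0I)
    fix i j z assume "i \<noteq> j" "z \<in> T i \<inter> T j"
    then obtain y y' where y: "\<bar>y\<bar> < h" "\<bar>y'\<bar> < h"
      "2 * h * sgn (u $ k) * real i + y = 2 * h * sgn (u $ k) * real j + y'"
      using inner_T[of z i] inner_T[of z j] by auto
    have "2 * h * \<bar>real i - real j\<bar> = \<bar>2 * h * sgn (u $ k) * (real i - real j)\<bar>"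
      using uk \<open>0 < h\<close> by (simp add: abs_mult abs_sgn_eq)
    also have "\<dots> = \<bar>y' - y\<bar>" using y by (simp add: algebra_simps)
    also have "\<dots> < 2 * h * 1" using y by linarith
    finally have "\<bar>real i - real j\<bar> < 1" using \<open>0 < h\<close> by simp
    then show False using \<open>i \<noteq> j\<close> by linarith
  qed
  have bound: "real n * measure lebesgue S \<le> c * (2 * a + real n * s)" for n
  proof -
    let ?B = "cbox (\<chi> i. - a) (\<chi> i. if i = k then a + real n * s else a) :: (real ^ 'd) set"
    have "0 \<in> ?B" using \<open>0 \<le> a\<close> \<open>s > 0\<close> by (simp add: mem_box_cart)
    then have "?B \<noteq> {}" by blast
    have "real n * measure lebesgue S = (\<Sum>j<n. measure lebesgue (T j))" by (simp add: T)
    also have "\<dots> = measure lebesgue (\<Union>j<n. T j)"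
    proof (rule measure_finite_Union[symmetric])
      show "T ` {..<n} \<subseteq> sets lebesgue" using fmeasurableD[OF T(1)] by blast
      show "emeasure lebesgue (T j) \<noteq> \<infinity>" for j using fmeasurableD2[OF T(1), of j] by simp
    qed (use disj in simp_all)
    also have "\<dots> \<le> measure lebesgue ?B"
    proof (rule measure_mono_fmeasurable)
      show "(\<Union>j<n. T j) \<subseteq> ?B"
      proof clarify
        fix j z assume "j < n" "z \<in> T j"
        then obtain w where w: "w \<in> S" "z = (real j * s) *\<^sub>R axis k 1 + w"
          unfolding T_def by blast
        have js: "0 \<le> real j * s" "real j * s \<le> real n * s" using \<open>s > 0\<close> \<open>j < n\<close> by auto
        have wi: "- a \<le> w $ i" "w $ i \<le> a" for i using w(1) by (auto simp: S_def mem_box_cart)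
        have "- a \<le> z $ i \<and> z $ i \<le> (if i = k then a + real n * s else a)" for i
          using js wi[of i] by (cases "i = k") (simp_all add: w(2) axis_def)
        then show "z \<in> ?B" by (auto simp: mem_box_cart)
      qed
      show "(\<Union>j<n. T j) \<in> sets lebesgue" using T by (auto simp: fmeasurableD)
    qed simp
    also have "\<dots> = (\<Prod>i\<in>UNIV. if i = k then 2 * a + real n * s else 2 * a)"
      using content_cbox_cart[OF \<open>?B \<noteq> {}\<close>] by (simp, intro prod.cong) auto
    also have "\<dots> = c * (2 * a + real n * s)"
      by (subst prod.remove[of _ k]) (auto simp: card_Diff_singleton c_def)
    finally show ?thesis .
  qed
  \<comment> \<open>Dividing \<open>bound\<close> by \<open>n\<close> and letting \<open>n\<close>
    grow removes the constant term \<open>2 * a * c\<close>.\<close>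
  have "measure lebesgue S \<le> c * s"
  proof (rule ccontr)
    assume "\<not> ?thesis"
    then obtain n where "2 * a * c < real n * (measure lebesgue S - c * s)"
      using reals_Archimedean3[of "measure lebesgue S - c * s"] by auto
    then show False using bound[of n] by (simp add: algebra_simps)
  qed
  also have "\<dots> \<le> c * (2 * h * sqrt (real CARD('d)))"
  proof (rule mult_left_mono)
    have "1 / \<bar>u $ k\<bar> \<le> sqrt (real CARD('d))" using k uk by (simp add: field_simps)
    then show "s \<le> 2 * h * sqrt (real CARD('d))"
      using mult_left_mono[of "1 / \<bar>u $ k\<bar>" "sqrt (real CARD('d))" "2 * h"] \<open>0 < h\<close> by (simp add: s_def)
    show "0 \<le> c" using \<open>0 \<le> a\<close> by (simp add: c_def)
  qed
  finally show ?thesis by (simp add: S_def c_def mult.assoc)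
qed

text \<open>Under \<open>small\<close>, the slabs of half-width \<open>h\<close> around the
  hyperplanes have total volume below \<open>(2 * a) ^ CARD('d)\<close>, so they cannot cover the
  cube.\<close>

lemma exists_point_far_from_hyperplanes:
  fixes u :: "'i \<Rightarrow> real ^ 'd"
  assumes F: "finite F" and u: "\<And>f. f \<in> F \<Longrightarrow> norm (u f) = 1" and "0 < a" "0 < h"
    and small: "real (card F) * h * sqrt (real CARD('d)) < a"
  obtains z where "\<And>k. \<bar>z $ k\<bar> \<le> a" "\<And>f. f \<in> F \<Longrightarrow> h \<le> \<bar>u f \<bullet> z\<bar>"
proof -
  let ?Q = "cbox (\<chi> k. - a) (\<chi> k. a) :: (real ^ 'd) set"
  define S where "S f = {z \<in> ?Q. \<bar>u f \<bullet> z\<bar> < h}" for f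
  have S: "S f \<in> lmeasurable" for f unfolding S_def by (rule slab_lmeasurable)
  have "measure lebesgue (\<Union>f\<in>F. S f) \<le> (\<Sum>f\<in>F. measure lebesgue (S f))"
    using S by (intro measure_UNION_le F) (auto simp: fmeasurableD)
  also have "\<dots> \<le> real (card F) * ((2 * a) ^ (CARD('d) - 1) * (2 * h) * sqrt (real CARD('d)))"
    unfolding S_def using u assms by (intro sum_bounded_above measure_cube_slab_le) auto
  also have "\<dots> = (2 * a) ^ (CARD('d) - 1) * 2 * (real (card F) * h * sqrt (real CARD('d)))"
    by (simp add: mult_ac)
  also have "\<dots> < (2 * a) ^ (CARD('d) - 1) * 2 * a"
    using small \<open>0 < a\<close> by (intro mult_strict_left_mono) auto
  also have "\<dots> = (2 * a) ^ CARD('d)"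
    using power_minus_mult[of "CARD('d)" "2 * a"] by (simp add: mult_ac)
  also have "\<dots> = measure lebesgue ?Q" using \<open>0 < a\<close> measure_cube[of a, where 'd = 'd] by simp
  finally have lt: "measure lebesgue (\<Union>f\<in>F. S f) < measure lebesgue ?Q" .
  have "\<not> ?Q \<subseteq> (\<Union>f\<in>F. S f)"
  proof
    assume "?Q \<subseteq> (\<Union>f\<in>F. S f)"
    then have "measure lebesgue ?Q \<le> measure lebesgue (\<Union>f\<in>F. S f)"
      using S F by (intro measure_mono_fmeasurable fmeasurable.finite_UN) (auto simp: fmeasurableD)
    then show False using lt by simp
  qed
  then obtain z where z: "z \<in> ?Q" "\<And>f. f \<in> F \<Longrightarrow> z \<notin> S f" by auto
  show ?thesis
  proof (rule that)
    show "\<bar>z $ k\<bar> \<le> a" for k using z(1) by (auto simp: mem_box_cart abs_le_iff minus_le_iff)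
    show "h \<le> \<bar>u f \<bullet> z\<bar>" if "f \<in> F" for f using z(1) z(2)[OF that] by (simp add: S_def)
  qed
qed

section \<open>The colorful Steinitz theorem\<close>

lemma exists_unit_normal:
  fixes S :: "'a::euclidean_space set"
  assumes "finite S" "card S < DIM('a)"
  obtains u where "norm u = 1" "\<And>x. x \<in> S \<Longrightarrow> u \<bullet> x = 0"
proof -
  have "dim S < DIM('a)" using dim_le_card'[OF assms(1)] assms(2) by linarith
  then obtain w where w: "w \<noteq> 0" "\<And>y. y \<in> span S \<Longrightarrow> orthogonal w y"
    using orthogonal_to_subspace_exists by blast
  show ?thesis
  proof (rule that)
    show "norm (w /\<^sub>R norm w) = 1" using w(1) by simp
    show "(w /\<^sub>R norm w) \<bullet> x = 0" if "x \<in> S" for x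
      using w(2)[OF span_base[OF that]] by (simp add: orthogonal_def)
  qed
qed

text \<open>The vector \<open>u i\<close> is normal to the facet opposite to \<open>x i\<close>, so
  pairing with it isolates the \<open>i\<close>-th coefficient up to the factor
  \<open>u i \<bullet> x i\<close>. For \<open>z\<close> this gives
  \<open>h \<le> t i * \<bar>u i \<bullet> x i\<bar>\<close>, and for \<open>v\<close> it gives
  \<open>\<bar>s i\<bar> * \<bar>u i \<bullet> x i\<bar> \<le> norm v\<close>; together they
  eliminate the unknown factor. In particular \<open>z + v\<close> stays in the cone when
  \<open>norm v \<le> h\<close>.\<close>

lemma representation_bound:
  fixes x u :: "'i \<Rightarrow> 'a::euclidean_space"
  assumes I: "finite I" "card I = DIM('a)"
    and t: "\<And>i. i \<in> I \<Longrightarrow> 0 \<le> t i" and z: "z = (\<Sum>i\<in>I. t i *\<^sub>R x i)" and "0 < h"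
    and u: "\<And>i. i \<in> I \<Longrightarrow> norm (u i) = 1" "\<And>i. i \<in> I \<Longrightarrow> h \<le> \<bar>u i \<bullet> z\<bar>"
    and ortho: "\<And>i j. i \<in> I \<Longrightarrow> j \<in> I \<Longrightarrow> j \<noteq> i \<Longrightarrow> u i \<bullet> x j = 0"
  shows "\<And>i. i \<in> I \<Longrightarrow> 0 < t i"
    and "\<exists>s. v = (\<Sum>i\<in>I. s i *\<^sub>R x i) \<and> (\<forall>i\<in>I. h * \<bar>s i\<bar> \<le> norm v * t i)"
proof -
  have coeff: "u i \<bullet> (\<Sum>j\<in>I. s j *\<^sub>R x j) = s i * (u i \<bullet> x i)" if "i \<in> I" for s i
  proof -
    have "u i \<bullet> (\<Sum>j\<in>I. s j *\<^sub>R x j) = (\<Sum>j\<in>I. if j = i then s i * (u i \<bullet> x i) else 0)"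
      unfolding inner_sum_right by (intro sum.cong) (auto simp: ortho that)
    then show ?thesis using I that by simp
  qed
  have h: "h \<le> t i * \<bar>u i \<bullet> x i\<bar>" if "i \<in> I" for i
    using u(2)[OF that] coeff[OF that, of t] t[OF that] by (simp add: z abs_mult)
  show t_pos: "0 < t i" if "i \<in> I" for i
    using h[OF that] t[OF that] \<open>0 < h\<close> by (cases "t i = 0") auto
  have nz: "u i \<bullet> x i \<noteq> 0" if "i \<in> I" for i using h[OF that] \<open>0 < h\<close> by auto
  have inj: "inj_on x I" by (rule inj_onI) (metis nz ortho)
  have "independent (x ` I)"
  proof
    assume "dependent (x ` I)"
    then obtain c i where "i \<in> I" "c (x i) \<noteq> 0" "(\<Sum>v\<in>x ` I. c v *\<^sub>R v) = 0"
      using I by (auto simp: dependent_finite)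
    then show False
      using coeff[of i "\<lambda>i. c (x i)"] nz[of i] by (simp add: sum.reindex[OF inj])
  qed
  moreover have "card (x ` I) = DIM('a)" using I inj by (simp add: card_image)
  ultimately have "UNIV \<subseteq> span (x ` I)" by (intro card_ge_dim_independent) auto
  then have "v \<in> range (\<lambda>c. \<Sum>w\<in>x ` I. c w *\<^sub>R w)" using I by (auto simp: span_finite)
  then obtain c where v: "v = (\<Sum>i\<in>I. c (x i) *\<^sub>R x i)" by (auto simp: sum.reindex[OF inj])
  have "h * \<bar>c (x i)\<bar> \<le> norm v * t i" if i: "i \<in> I" for i
  proof -
    have "h * \<bar>c (x i)\<bar> \<le> (t i * \<bar>u i \<bullet> x i\<bar>) * \<bar>c (x i)\<bar>"
      using h[OF i] by (intro mult_right_mono) auto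
    also have "\<dots> = t i * \<bar>u i \<bullet> v\<bar>"
      using coeff[OF i, of "\<lambda>i. c (x i)"] by (simp add: v abs_mult)
    also have "\<dots> \<le> t i * (norm (u i) * norm v)"
      using t[OF i] by (intro mult_left_mono Cauchy_Schwarz_ineq2) auto
    finally show ?thesis using u(1)[OF i] by (simp add: mult.commute)
  qed
  then show "\<exists>s. v = (\<Sum>i\<in>I. s i *\<^sub>R x i) \<and> (\<forall>i\<in>I. h * \<bar>s i\<bar> \<le> norm v * t i)"
    using v by (intro exI[of _ "\<lambda>i. c (x i)"]) auto
qed

lemma norm_le_sqrt_card:
  fixes z :: "real ^ 'd"
  assumes "\<And>k. \<bar>z $ k\<bar> \<le> a"
  shows "norm z \<le> a * sqrt (real CARD('d))"
proof -
  have "0 \<le> a" using assms[of undefined] by linarith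
  have "norm z = sqrt (\<Sum>k\<in>UNIV. (z $ k)\<^sup>2)" by (simp add: norm_vec_def L2_set_def)
  also have "\<dots> \<le> sqrt (real CARD('d) * a\<^sup>2)"
    using sum_bounded_above[of UNIV "\<lambda>k. (z $ k)\<^sup>2" "a\<^sup>2"] assms \<open>0 \<le> a\<close>
    by (simp add: abs_le_square_iff[symmetric])
  also have "\<dots> = a * sqrt (real CARD('d))" using \<open>0 \<le> a\<close> by (simp add: real_sqrt_mult)
  finally show ?thesis .
qed

section \<open>Numerical estimates for the radius\<close>

text \<open>The threshold is the reciprocal of the constant \<open>3 * (3 / 4)\<close> that arises
  in \<open>radius_bound\<close>.\<close>

lemma pi_div_exp_square_less: "pi / (exp 1)\<^sup>2 < 4 / 9"
proof -
  have "exp (1::real) \<ge> 27 / 10" using e_approx_32 unfolding abs_le_iff by simp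
  then have "(27 / 10)\<^sup>2 \<le> (exp (1::real))\<^sup>2" by (intro power_mono) auto
  then have "9 * pi < 4 * (exp 1)\<^sup>2" using pi_approx by (simp add: power2_eq_square)
  then show ?thesis by (simp add: field_simps)
qed

text \<open>For \<open>d = 2\<close> both sides equal \<open>3 / 2\<close>. For larger
  \<open>d\<close>, the bound 3 for the \<open>d\<close>-th power, divided by
  \<open>1 + 1 / d\<close>, suffices.\<close>

lemma one_plus_inverse_power_le:
  assumes "2 \<le> d"
  shows "(1 + 1 / real d) ^ (d - 1) \<le> 3 / 4 * real d"
proof (cases "d = 2")
  case True then show ?thesis by simp
next
  case False
  then have d: "3 \<le> d" using assms by simp
  have "(1 + 1 / real d) ^ d \<le> exp (1 / real d) ^ d" by (intro power_mono) auto
  also have "\<dots> = exp 1" using d by (simp add: exp_of_nat_mult[symmetric])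
  also have "\<dots> \<le> 3" by (rule exp_le)
  finally have "(1 + 1 / real d) ^ (d - 1) * (1 + 1 / real d) \<le> 3"
    using d by (subst power_minus_mult) auto
  also have "3 \<le> 3 / 4 * real d * (1 + 1 / real d)" using d by (simp add: field_simps)
  finally show ?thesis using d by (simp add: add_pos_nonneg)
qed

text \<open>Translates the hypothesis on \<open>r\<close> into the form needed for the volume
  comparison. Extracting \<open>d ^ 2\<close> from each factor \<open>d * (d + 1)\<close> leaves a
  power of \<open>1 + 1 / d\<close>, and all powers of \<open>d\<close> collect to
  \<open>d ^ (2 * d + 2)\<close>.\<close>

lemma radius_bound:
  assumes d: "2 \<le> d" and "0 < r"
    and r: "r \<le> pi / (exp 1)\<^sup>2 * real d powi (- 2 * int d - 2)"
  shows "r * (3 * real d ^ 3 * (real d * (real d + 1)) ^ (d - 1)) < 1"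
proof -
  obtain e where e: "d = Suc e" using d by (cases d) auto
  have "real d powi (- 2 * int d - 2) = 1 / real d ^ (2 * d + 2)"
  proof -
    have "- 2 * int d - 2 = - int (2 * d + 2)" by simp
    then show ?thesis by (simp only: power_int_minus power_int_of_nat inverse_eq_divide)
  qed
  then have r: "r \<le> pi / (exp 1)\<^sup>2 * (1 / real d ^ (2 * d + 2))" using r by simp
  have "real d * (real d + 1) = real d * real d * (1 + 1 / real d)"
    using d by (simp add: field_simps)
  then have "(real d * (real d + 1)) ^ (d - 1) = (real d * real d * (1 + 1 / real d)) ^ (d - 1)"
    by (simp only:)
  also have "\<dots> = real d ^ (2 * e) * (1 + 1 / real d) ^ (d - 1)"
    by (simp add: e power_mult_distrib power_mult power2_eq_square)
  also have "\<dots> \<le> real d ^ (2 * e) * (3 / 4 * real d)"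
    using one_plus_inverse_power_le[OF d] by (intro mult_left_mono) auto
  finally have "3 * real d ^ 3 * (real d * (real d + 1)) ^ (d - 1)
      \<le> 3 * real d ^ 3 * (real d ^ (2 * e) * (3 / 4 * real d))"
    by (intro mult_left_mono) auto
  also have "\<dots> = 9 / 4 * real d ^ (2 * d + 2)" by (simp add: e power_add eval_nat_numeral mult_ac)
  finally have "r * (3 * real d ^ 3 * (real d * (real d + 1)) ^ (d - 1)) \<le> r * (9 / 4 * real d ^ (2 * d + 2))"
    using \<open>0 < r\<close> by (intro mult_left_mono) auto
  also have "\<dots> \<le> pi / (exp 1)\<^sup>2 * (1 / real d ^ (2 * d + 2)) * (9 / 4 * real d ^ (2 * d + 2))"
    using r by (intro mult_right_mono) auto
  also have "\<dots> = pi / (exp 1)\<^sup>2 * (9 / 4)" using d by simp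
  also have "\<dots> < 4 / 9 * (9 / 4)" using pi_div_exp_square_less by (rule mult_strict_right_mono) simp
  finally show ?thesis by simp
qed

section \<open>Tools for dimension one\<close>

text \<open>Otherwise \<open>X\<close> would lie in an open half-space that misses \<open>p\<close>.
  The factor \<open>c\<close> covers both directions of the axis, through \<open>c = 1\<close> and
  \<open>c = - 1\<close>.\<close>

lemma convex_hull_exists_component_ge:
  fixes X :: "(real ^ 'd) set"
  assumes "p \<in> convex hull X"
  shows "\<exists>x\<in>X. c * p $ k \<le> c * x $ k"
proof (rule ccontr)
  assume "\<not> ?thesis"
  then have "X \<subseteq> {x. (c *\<^sub>R axis k 1) \<bullet> x < c * p $ k}" by (auto simp: inner_axis' not_le)
  then have "convex hull X \<subseteq> {x. (c *\<^sub>R axis k 1) \<bullet> x < c * p $ k}"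
    by (intro hull_minimal convex_halfspace_lt)
  then show False using assms by (auto simp: inner_axis')
qed

lemma convex_hull_two_points_dim_1:
  fixes x y v :: "real ^ 'd"
  assumes "CARD('d) = 1" "x $ k \<le> - 1" "1 \<le> y $ k" "norm v \<le> 1"
  shows "v \<in> convex hull {x, y}"
proof -
  have all: "j = k" for j :: 'd
  proof -
    obtain i :: 'd where "UNIV = {i}" using assms(1) card_1_singletonE by blast
    then show ?thesis by (metis UNIV_I singletonD)
  qed
  define c where "c = (v $ k - x $ k) / (y $ k - x $ k)"
  have v: "\<bar>v $ k\<bar> \<le> 1" using component_le_norm_cart[of v k] assms(4) by linarith
  have c: "0 \<le> c" "c \<le> 1" using assms(2,3) v by (auto simp: c_def field_simps)
  have "v $ k = (1 - c) * x $ k + c * y $ k"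
  proof -
    have "c * (y $ k - x $ k) = v $ k - x $ k" using assms(2,3) by (simp add: c_def)
    then show ?thesis by (simp add: algebra_simps)
  qed
  then have "v = (1 - c) *\<^sub>R x + c *\<^sub>R y"
    by (simp add: vec_eq_iff) (metis all)
  then show ?thesis using c by (auto simp: segment_convex_hull[symmetric] in_segment)
qed

section \<open>Dimension at least two\<close>

lemma colorful_steinitz_radius:
  fixes r :: real and X :: "nat \<Rightarrow> (real ^ 'd) set"
  assumes d2: "2 \<le> CARD('d)" and "0 < r"
    and small: "r * (3 * real CARD('d) ^ 3 * (real CARD('d) * (real CARD('d) + 1)) ^ (CARD('d) - 1)) < 1"
    and X: "\<And>i. i \<in> {1..2 * CARD('d)} \<Longrightarrow> cball 0 1 \<subseteq> convex hull (X i)"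
  shows "\<exists>x :: nat \<Rightarrow> real ^ 'd. (\<forall>i\<in>{1..2 * CARD('d)}. x i \<in> X i) \<and>
           cball 0 r \<subseteq> convex hull (x ` {1..2 * CARD('d)})"
proof -
  define D where "D = CARD('d)"
  define d where "d = real D"
  define N where "N = D * (D + 1)"
  define I where "I = {1..D}"
  define J where "J = {D+1..2*D}"
  have IJ: "{1..2 * CARD('d)} = I \<union> J" "I \<inter> J = {}" "finite I" "finite J" "card I = D" "card J = D"
    by (auto simp: I_def J_def D_def)
  have d: "2 \<le> d" using d2 by (simp add: d_def D_def)
  have sqd: "1 \<le> sqrt d" "sqrt d * sqrt d = d" using d by auto
  define P where "P = r * real N ^ (D - 1)"
  have "0 < N" by (simp add: N_def D_def)
  then have "P > 0" using \<open>0 < r\<close> by (simp add: P_def)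
  have "P * (3 * d ^ 3) < 1" using small by (simp add: P_def N_def d_def D_def algebra_simps)
  \<comment> \<open>The strictness of \<open>small\<close> leaves room for a shrinking factor
    \<open>\<theta> < 1\<close>.\<close>
  then obtain \<theta> where \<theta>: "P * (3 * d ^ 3) < \<theta>" "\<theta> < 1" using dense by blast
  have "0 < P * (3 * d ^ 3)" using \<open>P > 0\<close> d by simp
  then have \<theta>0: "0 < \<theta>" using \<theta>(1) by linarith
  define L where "L = 2 * d - 2 + sqrt d"
  have "L > 0" using d sqd(1) unfolding L_def by linarith
  define a where "a = \<theta> / L"
  have a: "a > 0" "a * L = \<theta>" using \<theta>0 \<open>L > 0\<close> by (auto simp: a_def)
  define m where "m = a * sqrt d"
  have "m > 0" using a d by (simp add: m_def)
  \<comment> \<open>Chosen so that the final radius \<open>\<epsilon> * h\<close> with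
    \<open>\<epsilon> = 1 / (2 + m)\<close> is exactly \<open>r\<close>.\<close>
  define h where "h = r * (2 + m)"
  have "h > 0" using \<open>0 < r\<close> \<open>m > 0\<close> by (simp add: h_def)

  have "\<forall>i\<in>I. \<exists>A. finite A \<and> A \<noteq> {} \<and> A \<subseteq> X i \<and> card A \<le> N \<and>
      (\<forall>z. (\<forall>k. \<bar>z $ k\<bar> \<le> a) \<longrightarrow> z \<in> convex hull (insert 0 A))"
  proof
    fix i assume "i \<in> I"
    then have "i \<in> {1..2 * CARD('d)}" using IJ by blast
    then obtain B where "finite B" "B \<noteq> {}" "B \<subseteq> X i" "card B \<le> CARD('d) * (CARD('d) + 1)"
      "\<And>z. (\<And>k. \<bar>z $ k\<bar> \<le> \<theta> / (2 * real CARD('d) - 2 + sqrt (real CARD('d)))) \<Longrightarrow>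
        z \<in> convex hull (insert 0 B)"
      using finite_subset_hull_contains_cube[OF X \<theta>0 \<theta>(2)] by blast
    then show "\<exists>A. finite A \<and> A \<noteq> {} \<and> A \<subseteq> X i \<and> card A \<le> N \<and>
      (\<forall>z. (\<forall>k. \<bar>z $ k\<bar> \<le> a) \<longrightarrow> z \<in> convex hull (insert 0 A))"
      unfolding a_def L_def d_def D_def N_def by (intro exI[of _ B] conjI) simp_all
  qed
  from bchoice[OF this] obtain A where A': "\<forall>i\<in>I. finite (A i) \<and> A i \<noteq> {} \<and> A i \<subseteq> X i \<and> card (A i) \<le> N \<and>
      (\<forall>z. (\<forall>k. \<bar>z $ k\<bar> \<le> a) \<longrightarrow> z \<in> convex hull (insert 0 (A i)))"
    by blast
  have A: "finite (A i)" "A i \<noteq> {}" "A i \<subseteq> X i" "card (A i) \<le> N" if "i \<in> I" for i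
    using A' that by auto
  have A_hull: "z \<in> convex hull (insert 0 (A i))" if "i \<in> I" "\<And>k. \<bar>z $ k\<bar> \<le> a" for i z
    using A' that by blast

  \<comment> \<open>An element is an omitted color \<open>i\<close> together with a rainbow choice
    from the other colors; it indexes one hyperplane through \<open>0\<close>.\<close>
  define F where "F = (SIGMA i:I. PiE (I - {i}) A)"
  have "finite F" unfolding F_def using A(1) IJ by (intro finite_SigmaI finite_PiE) auto
  have "card F = (\<Sum>i\<in>I. card (PiE (I - {i}) A))"
    unfolding F_def using A(1) IJ by (intro card_SigmaI ballI finite_PiE) auto
  also have "\<dots> \<le> (\<Sum>i\<in>I. N ^ (D - 1))"
  proof (rule sum_mono)
    fix i assume "i \<in> I"
    have "card (PiE (I - {i}) A) = (\<Prod>j\<in>I - {i}. card (A j))" using IJ by (intro card_PiE) auto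
    also have "\<dots> \<le> (\<Prod>j\<in>I - {i}. N)" using A(4) by (intro prod_mono) auto
    finally show "card (PiE (I - {i}) A) \<le> N ^ (D - 1)"
      using IJ \<open>i \<in> I\<close> by (simp add: card_Diff_singleton)
  qed
  finally have "card F \<le> D * N ^ (D - 1)" using IJ by simp
  then have "real (card F) \<le> d * real N ^ (D - 1)"
    unfolding d_def by (metis of_nat_le_iff of_nat_mult of_nat_power)
  then have "real (card F) * h * sqrt d \<le> d * real N ^ (D - 1) * h * sqrt d"
    using \<open>h > 0\<close> d by (intro mult_right_mono) auto
  also have "\<dots> = P * d * sqrt d * (2 + m)" by (simp add: P_def h_def mult_ac)
  also have "\<dots> < a"
  proof -
    \<comment> \<open>It follows that \<open>sqrt d \<le> 3 / 4 * d\<close>, which bounds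
      \<open>4 * (d - 1) * sqrt d + 3 * d\<close> by \<open>3 * d * d\<close>. With
      \<open>L * m \<le> sqrt d\<close> this is where the constant in \<open>3 * d ^ 3\<close> comes
      from.\<close>
    have "4 / 3 \<le> sqrt d" using d by (intro real_le_rsqrt) (simp add: power2_eq_square)
    then have "4 / 3 * sqrt d \<le> d" using sqd by (metis mult_right_mono real_sqrt_ge_zero d order_trans zero_le_numeral)
    then have "(d - 1) * sqrt d \<le> (d - 1) * (3 / 4 * d)" using d by (intro mult_left_mono) auto
    moreover have "L * m = \<theta> * sqrt d" using a by (simp add: m_def mult_ac)
    moreover have "\<theta> * sqrt d \<le> 1 * sqrt d" using \<theta>(2) d by (intro mult_right_mono) auto
    ultimately have "sqrt d * (L * (2 + m)) \<le> sqrt d * (2 * L + sqrt d)"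
      using d by (intro mult_left_mono) (auto simp: algebra_simps)
    also have "\<dots> = 4 * ((d - 1) * sqrt d) + 3 * d" using sqd by (simp add: L_def algebra_simps)
    also have "\<dots> \<le> 3 * d * d"
      using \<open>(d - 1) * sqrt d \<le> (d - 1) * (3 / 4 * d)\<close> by (simp add: algebra_simps)
    finally have "P * d * (sqrt d * (L * (2 + m))) \<le> P * d * (3 * d * d)"
      using \<open>P > 0\<close> d by (intro mult_left_mono) auto
    also have "\<dots> < a * L" using \<theta>(1) a by (simp add: power3_eq_cube mult_ac)
    finally have "P * d * sqrt d * (2 + m) * L < a * L" by (simp add: mult_ac)
    then show ?thesis using \<open>L > 0\<close> by simp
  qed
  \<comment> \<open>The point \<open>z\<close> is sought in a slightly smaller cube, so that
    \<open>e = a / b - 1\<close> provides the slack for both uses of the colorful theorem.\<close>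
  finally obtain b where b: "real (card F) * h * sqrt d < b" "b < a" using dense by blast
  have "0 \<le> real (card F) * h * sqrt d" using \<open>h > 0\<close> d by simp
  then have "b > 0" using b by linarith

  have "\<exists>u. norm u = 1 \<and> (\<forall>j\<in>I - {fst f}. u \<bullet> snd f j = 0)" if "f \<in> F" for f :: "nat \<times> (nat \<Rightarrow> real ^ 'd)"
  proof -
    have "card (snd f ` (I - {fst f})) \<le> card (I - {fst f})" using IJ by (intro card_image_le) auto
    also have "\<dots> < D" using that IJ d2 by (auto simp: F_def card_Diff_singleton D_def)
    finally have "card (snd f ` (I - {fst f})) < DIM(real ^ 'd)" by (simp add: D_def)
    then obtain u where "norm u = 1" "\<And>x. x \<in> snd f ` (I - {fst f}) \<Longrightarrow> u \<bullet> x = 0"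
      using exists_unit_normal[of "snd f ` (I - {fst f})"] IJ by auto
    then show ?thesis by blast
  qed
  then obtain u :: "nat \<times> (nat \<Rightarrow> real ^ 'd) \<Rightarrow> real ^ 'd" where
    u: "\<And>f. f \<in> F \<Longrightarrow> norm (u f) = 1"
       "\<And>f j. f \<in> F \<Longrightarrow> j \<in> I - {fst f} \<Longrightarrow> u f \<bullet> snd f j = 0"
    by metis

  obtain z where z: "\<And>k. \<bar>z $ k\<bar> \<le> b" "\<And>f. f \<in> F \<Longrightarrow> h \<le> \<bar>u f \<bullet> z\<bar>"
    using exists_point_far_from_hyperplanes[of F u b h] \<open>finite F\<close> u(1) \<open>b > 0\<close> \<open>h > 0\<close> b(1)
    unfolding d_def D_def by blast
  define e where "e = a / b - 1"
  have e: "e > 0" "(1 + e) * b = a" using b \<open>b > 0\<close> by (auto simp: e_def)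
  have "(1 + e) *\<^sub>R z \<in> convex hull (insert 0 (A i))" if "i \<in> I" for i
  proof (rule A_hull[OF that])
    fix k
    have "\<bar>((1 + e) *\<^sub>R z) $ k\<bar> = (1 + e) * \<bar>z $ k\<bar>" using e by (simp add: abs_mult)
    also have "\<dots> \<le> (1 + e) * b" using z(1)[of k] e(1) by (intro mult_left_mono) auto
    finally show "\<bar>((1 + e) *\<^sub>R z) $ k\<bar> \<le> a" using e by simp
  qed
  then obtain x where x: "\<And>i. i \<in> I \<Longrightarrow> x i \<in> A i" "z \<in> convex hull (insert 0 (x ` I))"
    using colorful_caratheodory_insert_0[of I A e z] IJ A(2) e(1) by (auto simp: D_def)
  obtain t where t: "\<And>i. i \<in> I \<Longrightarrow> 0 \<le> t i" "sum t I \<le> 1" "z = (\<Sum>i\<in>I. t i *\<^sub>R x i)"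
    using mem_convex_hull_insert_0_image[OF IJ(3) x(2)] by blast
  \<comment> \<open>Unit normal of the hyperplane attached to the points \<open>x j\<close> with
    \<open>j \<noteq> i\<close>. The restriction makes the choice an element of the extensional
    product in \<open>F\<close>.\<close>
  define w where "w i = u (i, restrict x (I - {i}))" for i
  have inF: "(i, restrict x (I - {i})) \<in> F" if "i \<in> I" for i
    using that x(1) by (auto simp: F_def)
  have w: "norm (w i) = 1" "h \<le> \<bar>w i \<bullet> z\<bar>" if "i \<in> I" for i
    using u(1)[OF inF[OF that]] z(2)[OF inF[OF that]] by (auto simp: w_def)
  have ortho: "w i \<bullet> x j = 0" if "i \<in> I" "j \<in> I" "j \<noteq> i" for i j
    using u(2)[OF inF[OF that(1)], of j] that by (simp add: w_def)
  have card_I: "card I = DIM(real ^ 'd)" using IJ by (simp add: D_def)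
  have t_pos: "0 < t i" if "i \<in> I" for i
    by (rule representation_bound(1)[OF IJ(3) card_I t(1) t(3) \<open>h > 0\<close> w ortho that])
  have repr: "\<exists>s. v = (\<Sum>i\<in>I. s i *\<^sub>R x i) \<and> (\<forall>i\<in>I. h * \<bar>s i\<bar> \<le> norm v * t i)" for v
    by (rule representation_bound(2)[OF IJ(3) card_I t(1) t(3) \<open>h > 0\<close> w ortho])

  \<comment> \<open>The point opposite to \<open>z\<close>, scaled by the norm bound
    \<open>m\<close> of the cube of half-side \<open>a\<close>, so that
    \<open>(1 + e) *\<^sub>R q\<close> stays in the unit ball.\<close>
  define q where "q = - (1 / m) *\<^sub>R z"
  have "(1 + e) *\<^sub>R q \<in> convex hull (insert 0 (X j))" if "j \<in> J" for j
  proof -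
    have "norm z \<le> b * sqrt d" using norm_le_sqrt_card[OF z(1)] by (simp add: d_def D_def)
    then have "(1 + e) * norm z \<le> (1 + e) * (b * sqrt d)" using e(1) by (intro mult_left_mono) auto
    also have "\<dots> = m" using e(2) by (simp add: m_def mult.assoc[symmetric])
    finally have "norm ((1 + e) *\<^sub>R q) \<le> 1" using e(1) \<open>m > 0\<close> by (simp add: q_def field_simps)
    then have "(1 + e) *\<^sub>R q \<in> cball 0 1" by (simp only: mem_cball_0)
    moreover have "j \<in> {1..2 * CARD('d)}" using that IJ by blast
    ultimately have "(1 + e) *\<^sub>R q \<in> convex hull (X j)" using X by blast
    then show ?thesis using hull_mono[of "X j" "insert 0 (X j)" convex] by blast
  qed
  moreover have "X j \<noteq> {}" if "j \<in> J" for j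
  proof -
    have "j \<in> {1..2 * CARD('d)}" using that IJ by blast
    then show ?thesis using X[of j] by auto
  qed
  ultimately obtain y where y: "\<And>j. j \<in> J \<Longrightarrow> y j \<in> X j" "q \<in> convex hull (insert 0 (y ` J))"
    using colorful_caratheodory_insert_0[of J X e q] IJ e(1) by (auto simp: D_def)
  obtain c where c: "\<And>j. j \<in> J \<Longrightarrow> 0 \<le> c j" "sum c J \<le> 1" "q = (\<Sum>j\<in>J. c j *\<^sub>R y j)"
    using mem_convex_hull_insert_0_image[OF IJ(4) y(2)] by blast

  define p where "p i = (if i \<in> I then x i else y i)" for i
  define \<epsilon> where "\<epsilon> = 1 / (2 + m)"
  have "2 + m \<noteq> 0" using \<open>m > 0\<close> by simp
  then have \<epsilon>: "\<epsilon> > 0" "\<epsilon> * (2 + m) = 1" "r = h * \<epsilon>"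
    using \<open>m > 0\<close> by (simp_all add: \<epsilon>_def h_def)
  \<comment> \<open>The coefficients of
    \<open>(v + \<epsilon> *\<^sub>R z) + (\<epsilon> * m) *\<^sub>R q\<close>, which equals
    \<open>v\<close> because \<open>m *\<^sub>R q = - z\<close>.\<close>
  have combo: "v = (\<Sum>i\<in>I \<union> J. (if i \<in> I then s i + \<epsilon> * t i else \<epsilon> * m * c i) *\<^sub>R p i)"
    if "v = (\<Sum>i\<in>I. s i *\<^sub>R x i)" for v s
  proof -
    have "(\<Sum>i\<in>I \<union> J. (if i \<in> I then s i + \<epsilon> * t i else \<epsilon> * m * c i) *\<^sub>R p i)
        = (\<Sum>i\<in>I. (s i + \<epsilon> * t i) *\<^sub>R x i) + (\<Sum>i\<in>J. (\<epsilon> * m * c i) *\<^sub>R y i)"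
      using IJ(2-4) by (subst sum.union_disjoint) (auto simp: p_def intro!: arg_cong2[where f = "(+)"] sum.cong)
    also have "(\<Sum>i\<in>I. (s i + \<epsilon> * t i) *\<^sub>R x i) = v + \<epsilon> *\<^sub>R z"
      by (simp add: that t(3) scaleR_add_left sum.distrib scaleR_sum_right)
    also have "(\<Sum>i\<in>J. (\<epsilon> * m * c i) *\<^sub>R y i) = (\<epsilon> * m) *\<^sub>R q"
      by (simp add: c(3) scaleR_sum_right)
    also have "\<dots> = - (\<epsilon> *\<^sub>R z)" using \<open>m > 0\<close> by (simp add: q_def)
    finally show ?thesis by simp
  qed
  have in_hull0: "v \<in> convex hull (insert 0 (p ` (I \<union> J)))" if v: "norm v \<le> r" for v
  proof -
    obtain s where s: "v = (\<Sum>i\<in>I. s i *\<^sub>R x i)" "\<And>i. i \<in> I \<Longrightarrow> h * \<bar>s i\<bar> \<le> norm v * t i"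
      using repr[of v] by blast
    \<comment> \<open>This makes \<open>s i + \<epsilon> * t i\<close> nonnegative and at most
      \<open>2 * \<epsilon> * t i\<close>. The total weight is thus at most
      \<open>2 * \<epsilon> + \<epsilon> * m = 1\<close>.\<close>
    have s_le: "\<bar>s i\<bar> \<le> \<epsilon> * t i" if "i \<in> I" for i
    proof -
      have "h * \<bar>s i\<bar> \<le> r * t i" using s(2)[OF that] mult_right_mono[OF v t(1)[OF that]] by linarith
      then show ?thesis using \<open>h > 0\<close> by (simp add: \<epsilon>(3) mult.assoc)
    qed
    let ?c = "\<lambda>i. if i \<in> I then s i + \<epsilon> * t i else \<epsilon> * m * c i"
    have "sum ?c (I \<union> J) = (\<Sum>i\<in>I. s i + \<epsilon> * t i) + (\<Sum>i\<in>J. \<epsilon> * m * c i)"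
      using IJ(2-4) by (subst sum.union_disjoint) (auto intro!: arg_cong2[where f = "(+)"] sum.cong)
    moreover have "(\<Sum>i\<in>I. s i + \<epsilon> * t i) \<le> 2 * \<epsilon>"
    proof -
      have "(\<Sum>i\<in>I. s i + \<epsilon> * t i) \<le> (\<Sum>i\<in>I. 2 * (\<epsilon> * t i))"
      proof (rule sum_mono)
        show "s i + \<epsilon> * t i \<le> 2 * (\<epsilon> * t i)" if "i \<in> I" for i using s_le[OF that] by linarith
      qed
      also have "\<dots> = 2 * \<epsilon> * sum t I" by (simp add: sum_distrib_left mult.assoc)
      also have "\<dots> \<le> 2 * \<epsilon> * 1" using t(2) \<epsilon>(1) by (intro mult_left_mono) auto
      finally show ?thesis by simp
    qed
    moreover have "(\<Sum>i\<in>J. \<epsilon> * m * c i) \<le> \<epsilon> * m"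
      using mult_left_mono[OF c(2), of "\<epsilon> * m"] \<epsilon>(1) \<open>m > 0\<close> by (simp add: sum_distrib_left)
    moreover have "2 * \<epsilon> + \<epsilon> * m = 1" using \<epsilon>(2) by (simp add: algebra_simps)
    ultimately have "sum ?c (I \<union> J) \<le> 1" by linarith
    moreover have "0 \<le> ?c i" if "i \<in> I \<union> J" for i
      using that s_le[of i] c(1)[of i] \<epsilon>(1) \<open>m > 0\<close> by (auto simp: abs_le_iff)
    ultimately have "(\<Sum>i\<in>I \<union> J. ?c i *\<^sub>R p i) \<in> convex hull (insert 0 (p ` (I \<union> J)))"
      using IJ by (intro convex_sum_le_1) (auto intro: hull_inc)
    then show ?thesis using combo[OF s(1)] by simp
  qed
  have "0 \<in> convex hull (p ` (I \<union> J))"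
  proof -
    define g where "g i = (if i \<in> I then \<epsilon> * t i else \<epsilon> * m * c i)" for i
    have g: "0 = (\<Sum>i\<in>I \<union> J. g i *\<^sub>R p i)"
      using combo[of 0 "\<lambda>_. 0"] by (simp add: g_def cong: if_cong)
    have g0: "0 \<le> g i" if "i \<in> I \<union> J" for i
      using that t(1)[of i] c(1)[of i] \<epsilon>(1) \<open>m > 0\<close> by (auto simp: g_def)
    have "1 \<in> I" using d2 by (simp add: I_def D_def)
    then have "0 < g 1" using t_pos[of 1] \<epsilon>(1) by (simp add: g_def)
    also have "g 1 \<le> sum g (I \<union> J)" using IJ g0 \<open>1 \<in> I\<close> by (intro member_le_sum) auto
    finally have G: "0 < sum g (I \<union> J)" .
    have "(\<Sum>i\<in>I \<union> J. (g i / sum g (I \<union> J)) *\<^sub>R p i) \<in> convex hull (p ` (I \<union> J))"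
      using IJ G g0 by (intro convex_sum) (auto simp: sum_divide_distrib[symmetric] intro: hull_inc)
    also have "(\<Sum>i\<in>I \<union> J. (g i / sum g (I \<union> J)) *\<^sub>R p i) = (1 / sum g (I \<union> J)) *\<^sub>R (\<Sum>i\<in>I \<union> J. g i *\<^sub>R p i)"
      by (simp add: scaleR_sum_right)
    also have "\<dots> = 0" by (simp flip: g)
    finally show ?thesis .
  qed
  then have "cball 0 r \<subseteq> convex hull (p ` (I \<union> J))"
    using in_hull0 hull_redundant[of 0 convex "p ` (I \<union> J)"] by (auto simp: mem_cball_0)
  moreover have "p i \<in> X i" if "i \<in> I \<union> J" for i
    using that x(1) A(3) y(1) by (auto simp: p_def)
  ultimately show ?thesis unfolding IJ(1) by (intro exI[of _ p]) auto
qed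

theorem lemma2p6:
  fixes r :: real
    and X :: "nat \<Rightarrow> (real ^ 'd) set"
  assumes "0 < r"
    and "r \<le> pi / (exp 1)\<^sup>2 * real CARD('d) powi (- 2 * int CARD('d) - 2)"
    and "\<And>i. i \<in> {1..2 * CARD('d)} \<Longrightarrow> cball 0 1 \<subseteq> convex hull (X i)"
  shows "\<exists>x :: nat \<Rightarrow> real ^ 'd. (\<forall>i\<in>{1..2 * CARD('d)}. x i \<in> X i) \<and>
           cball 0 r \<subseteq> convex hull (x ` {1..2 * CARD('d)})"
proof (cases "CARD('d) = 1")
  case True
  then have "r \<le> pi / (exp 1)\<^sup>2" using assms(2) by simp
  then have r: "r \<le> 1" using pi_div_exp_square_less by linarith
  fix k :: 'd
  have ax: "axis k 1 \<in> cball (0 :: real ^ 'd) 1" "- axis k 1 \<in> cball (0 :: real ^ 'd) 1"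
    by (simp_all add: norm_axis_1)
  have hull: "cball 0 1 \<subseteq> convex hull (X 1)" "cball 0 1 \<subseteq> convex hull (X 2)"
    using assms(3) True by simp_all
  \<comment> \<open>In dimension one there are just two sets: one supplies a point at or below
    \<open>- 1\<close>, the other a point at or above \<open>1\<close>, and the segment between them
    contains the unit ball.\<close>
  obtain x where x: "x \<in> X 1" "x $ k \<le> - 1"
    using convex_hull_exists_component_ge[OF subsetD[OF hull(1) ax(2)], of "- 1" k] by auto
  obtain y where y: "y \<in> X 2" "1 \<le> y $ k"
    using convex_hull_exists_component_ge[OF subsetD[OF hull(2) ax(1)], of 1 k] by auto
  have "{1..2 * CARD('d)} = {1, 2 :: nat}" using True by auto
  moreover have "cball 0 r \<subseteq> convex hull {x, y}"
    using convex_hull_two_points_dim_1[OF True x(2) y(2)] r by auto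
  ultimately show ?thesis using x(1) y(1) by (intro exI[of _ "\<lambda>i. if i = 1 then x else y"]) (auto simp: insert_commute)
next
  case False
  moreover have "0 < CARD('d)" by simp
  ultimately have d: "2 \<le> CARD('d)" by linarith
  show ?thesis
    by (rule colorful_steinitz_radius[OF d assms(1) radius_bound[OF d assms(1,2)] assms(3)])
qed

end
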